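(* Let $N\ge1$ and let $(t_1,\dots,t_N)\in\mathbb C^N$ be a fixed vector. Consider, for the unknowns $(c_1,\dots,c_N)\in\mathbb C^N$, the system $$c_j=(-1)^js_j^{(N)}(c_1,\dots,c_N),\quad j=1,\dots,N.\qquad(\mathrm S)$$ (1) If $t_1,\dots,t_N$ are pairwise distinct, then (S) is equivalent to (i.e. has the same solutions as) the system $$t_j^N+\sum_{m=1}^Nc_mt_j^{N-m}=\prod_{m=1}^N(t_j-c_m),\quad 1\le j\le N.$$ (2) If $t_2,\dots,t_N$ are pairwise distinct, then (S) is equivalent to the system consisting of $$t_1^N+\sum_{m=1}^Nc_mt_1^{N-m}=\prod_{m=1}^N(t_1-c_m)$$ together with $$Nt_j^{N-1}+\sum_{m=1}^{N-1}(N-m)t_j^{N-m-1}c_m=\sum_{n=1}^N\ \prod_{m=1,\,m\ne n}^N(t_j-c_m),\quad 2\le j\le N.$$ That is, all the fixed points of the Ulam map $\psi^{(N)}$ can be found by solving either one of these two systems.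
   Context: $s_j^{(N)}$ denotes the $j$-th elementary symmetric polynomial in $N$ variables. The Ulam map $\psi^{(N)}:\mathbb C^N\to\mathbb C^N$ is $(c_1,\dots,c_N)\mapsto(-s_1^{(N)},s_2^{(N)},\dots,(-1)^Ns_N^{(N)})$, with $s_j^{(N)}$ evaluated at $(c_1,\dots,c_N)$; its fixed points are exactly the solutions of (S). Convention: $t^0=1$ for all $t\in\mathbb C$. *)

theory Defs
  imports Complex_Main "HOL-Library.FuncSet"
begin

text \<open>
  \<open>\<complex>\<^sup>N\<close> with coordinates numbered \<open>1, \<dots>, N\<close>. Points are extensional functions
  (equal to \<open>undefined\<close> outside \<open>{1..N}\<close>), so that equality of functions is equality of
  \<open>N\<close>-tuples.
\<close>

definition complex_space :: "nat \<Rightarrow> (nat \<Rightarrow> complex) set" where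
  "complex_space N = {1..N} \<rightarrow>\<^sub>E UNIV"

definition elem_sym :: "nat \<Rightarrow> nat \<Rightarrow> (nat \<Rightarrow> complex) \<Rightarrow> complex" where
  "elem_sym N j c = (\<Sum>X | X \<subseteq> {1..N} \<and> card X = j. \<Prod>i\<in>X. c i)"

definition ulam_map :: "nat \<Rightarrow> (nat \<Rightarrow> complex) \<Rightarrow> (nat \<Rightarrow> complex)" where
  "ulam_map N c = (\<lambda>j\<in>{1..N}. (-1) ^ j * elem_sym N j c)"

definition ulam_system :: "nat \<Rightarrow> (nat \<Rightarrow> complex) \<Rightarrow> bool" where
  "ulam_system N c \<longleftrightarrow> (\<forall>j\<in>{1..N}. c j = (-1) ^ j * elem_sym N j c)"

definition value_equation :: "nat \<Rightarrow> complex \<Rightarrow> (nat \<Rightarrow> complex) \<Rightarrow> bool" where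
  "value_equation N x c \<longleftrightarrow>
     x ^ N + (\<Sum>m=1..N. c m * x ^ (N - m)) = (\<Prod>m=1..N. x - c m)"

text \<open>
  The \<open>x\<close>-derivative of the previous equation. The natural-number subtractions below never
  truncate, as \<open>N \<ge> 1\<close> in all uses and \<open>m \<le> N - 1\<close> in the sum, and \<open>x ^ 0 = 1\<close> for
  every \<open>x\<close>, including \<open>0\<close>.
\<close>

definition derivative_equation :: "nat \<Rightarrow> complex \<Rightarrow> (nat \<Rightarrow> complex) \<Rightarrow> bool" where
  "derivative_equation N x c \<longleftrightarrow>
     of_nat N * x ^ (N - 1) + (\<Sum>m=1..N-1. of_nat (N - m) * x ^ (N - m - 1) * c m)
       = (\<Sum>n=1..N. \<Prod>m\<in>{1..N} - {n}. x - c m)"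

end

theory Submission
  imports Defs "HOL-Computational_Algebra.Polynomial"
begin

text \<open>
  Let \<open>D\<close> be the monic polynomial with coefficients \<open>c\<^sub>1, \<dots>, c\<^sub>N\<close> minus the monic polynomial
  with roots \<open>c\<^sub>1, \<dots>, c\<^sub>N\<close>. By Vieta, the defects of the system (S) are the coefficients of
  \<open>D\<close>, and \<open>D\<close> has degree less than \<open>N\<close>. Hence (S) says \<open>D = 0\<close>, which follows from \<open>N\<close>
  distinct roots of \<open>D\<close>; it also follows from \<open>N - 1\<close> distinct roots of the derivative, which make \<open>D\<close>
  constant, together with one root of \<open>D\<close>.
\<close>

definition ulam_defect_poly :: "nat \<Rightarrow> (nat \<Rightarrow> complex) \<Rightarrow> complex poly" where
  "ulam_defect_poly N c = monom 1 N + (\<Sum>m=1..N. monom (c m) (N - m)) - (\<Prod>m=1..N. [:- c m, 1:])"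

text \<open>Vieta's formula. Each factor is split as the constant \<open>- c m\<close> plus the
  indeterminate; expanding the product chooses the constant on a subset \<open>X\<close>, and
  grouping the subsets by cardinality yields the elementary symmetric polynomials.\<close>

lemma prod_linear_factors_elem_sym:
  "(\<Prod>m=1..N. [:- c m, 1:]) = (\<Sum>j=0..N. monom ((-1) ^ j * elem_sym N j c) (N - j))"
proof -
  have summand: "(\<Prod>i\<in>X. [:- c i:]) * (\<Prod>i\<in>{1..N} - X. monom 1 1)
      = monom ((-1) ^ card X * (\<Prod>i\<in>X. c i)) (N - card X)" if "X \<subseteq> {1..N}" for X
  proof -
    have "finite X" using that finite_subset by blast
    then have "(\<Prod>i\<in>X. [:- c i:]) = [:(-1) ^ card X * (\<Prod>i\<in>X. c i):]"
      by (induction X rule: finite_induct) (auto simp: mult_ac)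
    moreover have "(\<Prod>i\<in>{1..N} - X. monom (1::complex) 1) = monom 1 (N - card X)"
      using that \<open>finite X\<close> by (simp add: card_Diff_subset monom_power)
    ultimately show ?thesis by (simp add: smult_monom)
  qed
  have "(\<Prod>m=1..N. [:- c m, 1:]) = (\<Prod>m=1..N. [:- c m:] + monom 1 1)"
    by (rule prod.cong) (auto simp: monom_altdef)
  also have "\<dots> = (\<Sum>X\<in>Pow {1..N}. (\<Prod>i\<in>X. [:- c i:]) * (\<Prod>i\<in>{1..N} - X. monom 1 1))"
    by (rule prod_add) simp
  also have "\<dots> = (\<Sum>X\<in>Pow {1..N}. monom ((-1) ^ card X * (\<Prod>i\<in>X. c i)) (N - card X))"
    using summand by (intro sum.cong) auto
  also have "\<dots> = (\<Sum>j=0..N. \<Sum>X\<in>{X \<in> Pow {1..N}. card X = j}.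
      monom ((-1) ^ card X * (\<Prod>i\<in>X. c i)) (N - card X))"
    by (rule sum.group[symmetric]) (auto dest: card_mono[rotated])
  also have "\<dots> = (\<Sum>j=0..N. monom ((-1) ^ j * elem_sym N j c) (N - j))"
    by (rule sum.cong) (simp_all add: elem_sym_def sum_distrib_left monom_sum)
  finally show ?thesis .
qed

lemma elem_sym_0: "elem_sym N 0 c = 1"
proof -
  \<comment> \<open>Infinite sets also have \<open>card\<close> equal to 0, hence the appeal to
    finiteness of subsets.\<close>
  have "{X. X \<subseteq> {1..N} \<and> card X = 0} = {{}}"
    using finite_subset[of _ "{1..N}"] by fastforce
  then show ?thesis by (simp add: elem_sym_def)
qed

text \<open>The index 0 term of Vieta's formula is \<open>monom 1 N\<close>, so the leading terms of
  the two monic polynomials cancel.\<close>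

lemma ulam_defect_poly_eq_sum:
  "ulam_defect_poly N c = (\<Sum>m=1..N. monom (c m - (-1) ^ m * elem_sym N m c) (N - m))"
proof -
  have "(\<Prod>m=1..N. [:- c m, 1:])
      = monom 1 N + (\<Sum>j=1..N. monom ((-1) ^ j * elem_sym N j c) (N - j))"
    unfolding prod_linear_factors_elem_sym
    by (simp add: sum.atLeast_Suc_atMost elem_sym_0)
  then show ?thesis
    unfolding ulam_defect_poly_def diff_monom[symmetric] sum_subtractf by simp
qed

lemma coeff_ulam_defect_poly:
  assumes "j \<in> {1..N}"
  shows "coeff (ulam_defect_poly N c) (N - j) = c j - (-1) ^ j * elem_sym N j c"
proof -
  \<comment> \<open>On \<open>{1..N}\<close> the map taking \<open>m\<close> to \<open>N - m\<close>
    is injective, so a single monomial contributes.\<close>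
  have "coeff (ulam_defect_poly N c) (N - j)
      = (\<Sum>m=1..N. if m = j then c m - (-1) ^ m * elem_sym N m c else 0)"
    using assms unfolding ulam_defect_poly_eq_sum coeff_sum
    by (intro sum.cong) auto
  then show ?thesis using assms by simp
qed

lemma degree_ulam_defect_poly_less:
  assumes "N \<ge> 1"
  shows "degree (ulam_defect_poly N c) < N"
proof -
  have "degree (ulam_defect_poly N c) \<le> N - 1"
    unfolding ulam_defect_poly_eq_sum
    by (rule degree_sum_le) (auto intro: order.trans[OF degree_monom_le])
  with assms show ?thesis by simp
qed

lemma ulam_system_iff_defect_poly_0: "ulam_system N c \<longleftrightarrow> ulam_defect_poly N c = 0"
proof
  assume "ulam_system N c"
  then show "ulam_defect_poly N c = 0"
    unfolding ulam_defect_poly_eq_sum by (intro sum.neutral) (auto simp: ulam_system_def)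
next
  assume "ulam_defect_poly N c = 0"
  then show "ulam_system N c"
    unfolding ulam_system_def using coeff_ulam_defect_poly[of _ N c] by fastforce
qed

lemma value_equation_iff_root: "value_equation N x c \<longleftrightarrow> poly (ulam_defect_poly N c) x = 0"
  by (simp add: value_equation_def ulam_defect_poly_def poly_monom poly_sum poly_prod)

lemma derivative_equation_iff_root:
  assumes "N \<ge> 1"
  shows "derivative_equation N x c \<longleftrightarrow> poly (pderiv (ulam_defect_poly N c)) x = 0"
proof -
  \<comment> \<open>The summand at \<open>m = N\<close> comes from the constant coefficient
    \<open>c N\<close>: its factor \<open>of_nat (N - m)\<close> vanishes.\<close>
  have "{1..N} = insert N {1..N - 1}" using assms by auto
  then have "(\<Sum>m=1..N. of_nat (N - m) * x ^ (N - m - 1) * c m)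
      = (\<Sum>m=1..N-1. of_nat (N - m) * x ^ (N - m - 1) * c m)"
    using assms by simp
  moreover have "poly (pderiv (ulam_defect_poly N c)) x
      = of_nat N * x ^ (N - 1) + (\<Sum>m=1..N. of_nat (N - m) * x ^ (N - m - 1) * c m)
        - (\<Sum>n=1..N. \<Prod>m\<in>{1..N} - {n}. x - c m)"
    \<comment> \<open>The instance of \<open>higher_pderiv_sum\<close> at order 1 differentiates the
      sum termwise; the Leibniz rule \<open>pderiv_prod\<close> omits one linear factor at a time,
      whose derivative is 1.\<close>
    by (simp add: ulam_defect_poly_def pderiv_add pderiv_diff higher_pderiv_sum[of 1, simplified] pderiv_monom pderiv_prod
        pderiv_pCons poly_monom poly_sum poly_prod mult_ac)
  ultimately show ?thesis by (simp add: derivative_equation_def)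
qed

text \<open>Injectivity makes the roots \<open>t j\<close> distinct, so there are
  \<open>card A\<close> of them, more than the degree allows for a nonzero polynomial.\<close>

lemma poly_eq_0_if_roots_inj_on:
  fixes p :: "'a::idom poly"
  assumes "inj_on t A" "degree p < card A" "\<And>j. j \<in> A \<Longrightarrow> poly p (t j) = 0"
  shows "p = 0"
  by (rule poly_eqI_degree[of "t ` A"]) (use assms in \<open>auto simp: card_image\<close>)

lemma ulam_system_iff_value_equations:
  assumes "N \<ge> 1" "inj_on t {1..N}"
  shows "ulam_system N c \<longleftrightarrow> (\<forall>j\<in>{1..N}. value_equation N (t j) c)"
  unfolding ulam_system_iff_defect_poly_0 value_equation_iff_root
  using poly_eq_0_if_roots_inj_on[OF assms(2)] degree_ulam_defect_poly_less[OF assms(1)]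
  by auto

lemma ulam_system_iff_derivative_equations:
  assumes "N \<ge> 1" "inj_on t {2..N}"
  shows "ulam_system N c \<longleftrightarrow>
    value_equation N (t 1) c \<and> (\<forall>j\<in>{2..N}. derivative_equation N (t j) c)"
proof -
  let ?D = "ulam_defect_poly N c"
  have "?D = 0" if root: "poly ?D (t 1) = 0" and roots: "\<forall>j\<in>{2..N}. poly (pderiv ?D) (t j) = 0"
  proof -
    have "degree ?D = 0"
    proof (rule ccontr)
      assume "degree ?D \<noteq> 0"
      \<comment> \<open>In characteristic 0 the degree drops by exactly one. Since
        \<open>degree ?D\<close> is positive, the drop is genuine and
        \<open>degree ?D - 1 < N - 1\<close>.\<close>
      then have "degree (pderiv ?D) < card {2..N}"
        using degree_ulam_defect_poly_less[OF assms(1), of c] by (simp add: degree_pderiv)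
      then have "pderiv ?D = 0"
        using poly_eq_0_if_roots_inj_on[OF assms(2)] roots by blast
      with \<open>degree ?D \<noteq> 0\<close> show False by (simp add: pderiv_eq_0_iff)
    qed
    with root show ?thesis by (auto elim!: degree_eq_zeroE)
  qed
  then show ?thesis
    unfolding ulam_system_iff_defect_poly_0 value_equation_iff_root
      derivative_equation_iff_root[OF assms(1)]
    by auto
qed

text \<open>Both \<open>c\<close> and \<open>ulam_map N c\<close> are extensional on
  \<open>{1..N}\<close>, so their equality as functions is coordinatewise equality there.\<close>

lemma ulam_map_fixed_point_iff:
  assumes "c \<in> complex_space N"
  shows "ulam_map N c = c \<longleftrightarrow> ulam_system N c"
proof -
  have "ulam_map N c = c \<longleftrightarrow> (\<forall>j\<in>{1..N}. ulam_map N c j = c j)"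
    using assms extensionalityI[of "ulam_map N c" "{1..N}" c]
    unfolding complex_space_def ulam_map_def PiE_def by fastforce
  then show ?thesis
    unfolding ulam_system_def ulam_map_def by (simp add: eq_commute[of "c _"])
qed

theorem theorem2p4:
  fixes N :: nat and t :: "nat \<Rightarrow> complex"
  assumes "N \<ge> 1" and "t \<in> complex_space N"
  shows
    "(inj_on t {1..N} \<longrightarrow>
        (\<forall>c\<in>complex_space N.
           ulam_system N c \<longleftrightarrow> (\<forall>j\<in>{1..N}. value_equation N (t j) c)) \<and>
        {c \<in> complex_space N. ulam_map N c = c}
          = {c \<in> complex_space N. \<forall>j\<in>{1..N}. value_equation N (t j) c})
     \<and>
     (inj_on t {2..N} \<longrightarrow>
        (\<forall>c\<in>complex_space N.
           ulam_system N c \<longleftrightarrow>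
             value_equation N (t 1) c \<and> (\<forall>j\<in>{2..N}. derivative_equation N (t j) c)) \<and>
        {c \<in> complex_space N. ulam_map N c = c}
          = {c \<in> complex_space N.
               value_equation N (t 1) c \<and> (\<forall>j\<in>{2..N}. derivative_equation N (t j) c)})"
  \<comment> \<open>For the set equalities, \<open>conj_cong\<close> provides the membership in
    \<open>complex_space N\<close> under which fixed points are the solutions of (S).\<close>
  by (intro conjI impI ballI Collect_cong conj_cong refl)
    (simp_all only: ulam_map_fixed_point_iff ulam_system_iff_value_equations[OF assms(1)]
      ulam_system_iff_derivative_equations[OF assms(1)])

end
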